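(* Let $V$ be a finite set with $n$ elements and, for each $i\in V$, let $w_i$ be a real-valued function defined on the subsets of $V\setminus\{i\}$. Then the weighted sum over acyclic digraphs $$a_V=\sum_{D}\prod_{i\in V} w_i(D_i),$$ where $D$ ranges over all acyclic directed graphs with node set $V$ and $D_i\subseteq V\setminus\{i\}$ is the set of in-neighbours of node $i$ in $D$, can be computed using $O(2.985^n)$ arithmetic operations.
   Context: Arithmetic operations are additions (subtractions) and multiplications of numbers; the input is the collection of values $w_i(X)$ for all $i\in V$ and $X\subseteq V\setminus\{i\}$. *)

theory Defs
  imports Complex_Main "HOL-Library.Landau_Symbols"
begin

definition acyclic_digraphs :: "'a set \<Rightarrow> ('a \<times> 'a) set set" where
  "acyclic_digraphs V = {D. D \<subseteq> V \<times> V \<and> acyclic D}"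

text \<open>A pair \<open>(j, i)\<close> in \<open>D\<close> is an arc from \<open>j\<close> to \<open>i\<close>.\<close>

definition in_neighbours :: "('a \<times> 'a) set \<Rightarrow> 'a \<Rightarrow> 'a set" where
  "in_neighbours D i = {j. (j, i) \<in> D}"

definition weighted_dag_sum :: "'a set \<Rightarrow> ('a \<Rightarrow> 'a set \<Rightarrow> real) \<Rightarrow> real" where
  "weighted_dag_sum V w = (\<Sum>D\<in>acyclic_digraphs V. \<Prod>i\<in>V. w i (in_neighbours D i))"

text \<open>
  Algorithms are straight-line programs over a set of inputs with names of type \<open>'x\<close>.
  \<open>Reg k\<close> refers to the result of the \<open>k\<close>-th instruction (counted from 0), so
  intermediate results can be reused at no cost. Reading an input or writing down a rational
  constant is free; every instruction is one arithmetic operation, also when one of its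
  operands is a constant.
\<close>

datatype 'x operand = Input 'x | Const rat | Reg nat

datatype 'x instr =
    Add "'x operand" "'x operand"
  | Sub "'x operand" "'x operand"
  | Mul "'x operand" "'x operand"

datatype 'x program = Program (instrs: "'x instr list") (result: "'x operand")

fun operand_value :: "('x \<Rightarrow> real) \<Rightarrow> real list \<Rightarrow> 'x operand \<Rightarrow> real" where
  "operand_value inp regs (Input x) = inp x"
| "operand_value inp regs (Const c) = of_rat c"
| "operand_value inp regs (Reg k) = regs ! k"

fun instr_value :: "('x \<Rightarrow> real) \<Rightarrow> real list \<Rightarrow> 'x instr \<Rightarrow> real" where
  "instr_value inp regs (Add a b) = operand_value inp regs a + operand_value inp regs b"
| "instr_value inp regs (Sub a b) = operand_value inp regs a - operand_value inp regs b"
| "instr_value inp regs (Mul a b) = operand_value inp regs a * operand_value inp regs b"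

fun run_instrs :: "('x \<Rightarrow> real) \<Rightarrow> 'x instr list \<Rightarrow> real list \<Rightarrow> real list" where
  "run_instrs inp [] regs = regs"
| "run_instrs inp (c # cs) regs = run_instrs inp cs (regs @ [instr_value inp regs c])"

definition program_value :: "('x \<Rightarrow> real) \<Rightarrow> 'x program \<Rightarrow> real" where
  "program_value inp p = operand_value inp (run_instrs inp (instrs p) []) (result p)"

definition num_operations :: "'x program \<Rightarrow> nat" where
  "num_operations p = length (instrs p)"

text \<open>
  A program is well formed with respect to a set \<open>X\<close> of available inputs if it reads
  no other inputs and only registers that have been written before (otherwise the list access
  in \<open>operand_value\<close> would be out of range).
\<close>

fun operand_ok :: "'x set \<Rightarrow> nat \<Rightarrow> 'x operand \<Rightarrow> bool" where
  "operand_ok X n (Input x) \<longleftrightarrow> x \<in> X"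
| "operand_ok X n (Const c) \<longleftrightarrow> True"
| "operand_ok X n (Reg k) \<longleftrightarrow> k < n"

fun instr_operands :: "'x instr \<Rightarrow> 'x operand set" where
  "instr_operands (Add a b) = {a, b}"
| "instr_operands (Sub a b) = {a, b}"
| "instr_operands (Mul a b) = {a, b}"

definition program_ok :: "'x set \<Rightarrow> 'x program \<Rightarrow> bool" where
  "program_ok X p \<longleftrightarrow>
     (\<forall>k < length (instrs p). \<forall>a \<in> instr_operands (instrs p ! k). operand_ok X k a) \<and>
     operand_ok X (length (instrs p)) (result p)"

definition weight_inputs :: "'a set \<Rightarrow> ('a \<times> 'a set) set" where
  "weight_inputs V = (SIGMA i:V. Pow (V - {i}))"

definition computes_weighted_dag_sum :: "'a set \<Rightarrow> ('a \<times> 'a set) program \<Rightarrow> bool" where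
  "computes_weighted_dag_sum V p \<longleftrightarrow>
     program_ok (weight_inputs V) p \<and>
     (\<forall>w :: 'a \<Rightarrow> 'a set \<Rightarrow> real.
        program_value (\<lambda>(i, X). w i X) p = weighted_dag_sum V w)"

end

theory Submission
  imports Defs "HOL-Library.Function_Algebras" "HOL-Library.FuncSet" "HOL-Library.Cardinality"
    "HOL-Real_Asymp.Real_Asymp"
begin

text \<open>
  Write \<open>a\<^sub>T\<close> for the weighted sum over the acyclic digraphs on \<open>T\<close> and
  \<open>f\<^sub>i(S) = - (\<Sum>X\<subseteq>S. w\<^sub>i(X))\<close>. Since \<open>a\<^sub>S (\<Prod>i\<in>T-S. - f\<^sub>i(S))\<close> sums the weights of the acyclic
  digraphs on \<open>T\<close> in which all elements of \<open>T - S\<close> are sinks, and a nonempty acyclic digraph has a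
  sink, inclusion-exclusion gives \<open>(\<Sum>S\<subseteq>T. a\<^sub>S (\<Prod>i\<in>T-S. f\<^sub>i(S))) = 0\<close> for \<open>T \<noteq> {}\<close>. Solving for \<open>a\<^sub>T\<close>
  by fixed-point iteration takes \<open>n\<close> evaluations of the multi-subset transform
  \<open>T \<mapsto> (\<Sum>S\<subseteq>T. a\<^sub>S (\<Prod>i\<in>T-S. f\<^sub>i(S)))\<close>.

  The transform is made bilinear by splitting the product between one third of the elements and the
  other two thirds. Group the elements into triples \<open>(x, y, z)\<close> with \<open>x\<close> from the first part and \<open>y, z\<close>
  from the second. Each triple contributes a tensor with 27 terms, one for each way of placing its
  elements in \<open>S\<close>, \<open>T - S\<close> or outside \<open>T\<close>, and the bilinear map is the tensor power of this tensor. Eight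
  of the 27 terms form a product of two 2x2 matrices, so by Strassen's identity the tensor has rank at
  most 26. Its \<open>n/3\<close>-th power is evaluated with \<open>O(n 26\<^bsup>n/3\<^esup>)\<close> operations, and \<open>26 < 2.963\<^sup>3\<close>.

  Operations are counted in an arbitrary commutative ring; for straight-line programs this is the
  ring of functions from input assignments to reals.
\<close>

section \<open>Counting ring operations\<close>

text \<open>\<open>F\<close> collects the values known so far. A computed value joins
  \<open>F\<close> and can be reused for free, as with registers. Since \<open>base\<close> allows
  any \<open>n\<close>, the number is an upper bound on the operations rather than an exact
  count.\<close>

inductive generates :: "'r::comm_ring_1 set \<Rightarrow> nat \<Rightarrow> 'r set \<Rightarrow> bool" where
  base: "H \<subseteq> F \<Longrightarrow> generates F n H"
| step: "\<lbrakk>a \<in> F; b \<in> F; c \<in> {a + b, a - b, a * b}; generates (insert c F) n H\<rbrakk>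
    \<Longrightarrow> generates F (Suc n) H"

lemma generates_mono_left:
  "generates F n H \<Longrightarrow> F \<subseteq> F' \<Longrightarrow> generates F' n H"
proof (induction arbitrary: F' rule: generates.induct)
  case (step a F b c n H)
  have "generates (insert c F') n H"
    by (rule step.IH) (use step.prems in auto)
  with step.hyps(1-3) step.prems show ?case
    by (meson generates.step subsetD)
qed (auto intro: generates.base)

lemma generates_mono:
  assumes "generates F n H" "n \<le> m" "H' \<subseteq> H"
  shows "generates F m H'"
  using assms
proof (induction arbitrary: m rule: generates.induct)
  case (step a F b c n H)
  then obtain m' where "m = Suc m'" "n \<le> m'"
    by (cases m) auto
  with step show ?case
    by (auto intro: generates.step)
qed (auto intro: generates.base)

lemma generates_keep: "generates F n H \<Longrightarrow> generates F n (F \<union> H)"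
proof (induction rule: generates.induct)
  case (step a F b c n H)
  have "generates (insert c F) n (F \<union> H)"
    by (rule generates_mono[OF step.IH]) auto
  with step.hyps(1-3) show ?case
    by (rule generates.step)
qed (auto intro: generates.base)

lemma generates_trans:
  assumes "generates F n H" "generates (F \<union> H) m K"
  shows "generates F (n + m) K"
  using assms
proof (induction rule: generates.induct)
  case (base H F n)
  then show ?case
    by (metis generates_mono le_add2 order_refl sup.absorb1)
next
  case (step a F b c n H)
  have "generates (insert c F) (n + m) K"
    by (rule step.IH, rule generates_mono_left[OF step.prems]) auto
  with step.hyps(1-3) show ?case
    by (auto intro: generates.step)
qed

lemma generates_trans_Un:
  assumes "generates F n H" "generates (F \<union> H) m K"
  shows "generates F (n + m) (H \<union> K)"
  using generates_trans[OF assms(1) generates_keep[OF assms(2)]]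
  by (rule generates_mono) auto

lemma generates_Un:
  assumes "generates F n H" "generates F m K"
  shows "generates F (n + m) (H \<union> K)"
  by (rule generates_trans_Un[OF assms(1)], rule generates_mono_left[OF assms(2)]) auto

lemma generates_UN:
  assumes "finite I" "\<And>i. i \<in> I \<Longrightarrow> generates F n (H i)"
  shows "generates F (card I * n) (\<Union>i\<in>I. H i)"
  using assms
proof (induction rule: finite_induct)
  case (insert i I)
  have "generates F (n + card I * n) (H i \<union> (\<Union>i\<in>I. H i))"
    using insert by (intro generates_Un) auto
  with insert.hyps show ?case by simp
qed (auto intro: generates.base)

lemma generates_image:
  assumes "finite I" "\<And>i. i \<in> I \<Longrightarrow> generates F n {h i}"
  shows "generates F (card I * n) (h ` I)"
  using generates_UN[of I F n "\<lambda>i. {h i}"] assms by (simp add: UNION_singleton_eq_range)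

lemma generates_op:
  assumes "generates F n {a}" "generates F m {b}" "c \<in> {a + b, a - b, a * b}"
  shows "generates F (Suc (n + m)) {c}"
proof -
  have "generates F ((n + m) + 1) {c}"
  proof (rule generates_trans[OF generates_Un[OF assms(1,2)]])
    show "generates (F \<union> ({a} \<union> {b})) 1 {c}"
      unfolding One_nat_def by (rule generates.step[OF _ _ assms(3)]) (auto intro: generates.base)
  qed
  then show ?thesis by simp
qed

lemma generates_sum:
  assumes "finite I" "0 \<in> F" "\<And>i. i \<in> I \<Longrightarrow> generates F n {h i}"
  shows "generates F (card I * Suc n) {\<Sum>i\<in>I. h i}"
  using assms
proof (induction rule: finite_induct)
  case (insert i I)
  have "generates F (Suc (n + card I * Suc n)) {h i + (\<Sum>i\<in>I. h i)}"
    using insert by (intro generates_op[of F n "h i" "card I * Suc n" "\<Sum>i\<in>I. h i"]) auto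
  with insert.hyps show ?case by (simp add: algebra_simps)
qed (auto intro: generates.base)

lemma generates_prod:
  assumes "finite I" "1 \<in> F" "\<And>i. i \<in> I \<Longrightarrow> h i \<in> F"
  shows "generates F (card I) {\<Prod>i\<in>I. h i}"
  using assms
proof (induction rule: finite_induct)
  case (insert i I)
  have "generates F (Suc (0 + card I)) {h i * (\<Prod>i\<in>I. h i)}"
    using insert by (intro generates_op[of F 0 "h i" "card I"]) (auto intro: generates.base)
  with insert.hyps show ?case by simp
qed (auto intro: generates.base)

section \<open>Straight-line programs\<close>

lemma run_instrs_append:
  "run_instrs inp (cs @ ds) regs = run_instrs inp ds (run_instrs inp cs regs)"
  by (induction cs arbitrary: regs) auto

lemma length_run_instrs [simp]: "length (run_instrs inp cs regs) = length regs + length cs"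
  by (induction cs arbitrary: regs) auto

definition instrs_ok :: "'x set \<Rightarrow> 'x instr list \<Rightarrow> bool" where
  "instrs_ok X cs \<longleftrightarrow> (\<forall>k < length cs. \<forall>a \<in> instr_operands (cs ! k). operand_ok X k a)"

text \<open>Operands become elements of the pointwise ring of functions from input assignments to
  reals, to which \<open>generates\<close> applies.\<close>

definition operand_function :: "'x instr list \<Rightarrow> 'x operand \<Rightarrow> ('x \<Rightarrow> real) \<Rightarrow> real" where
  "operand_function cs a = (\<lambda>inp. operand_value inp (run_instrs inp cs []) a)"

definition available :: "'x set \<Rightarrow> 'x instr list \<Rightarrow> (('x \<Rightarrow> real) \<Rightarrow> real) set" where
  "available X cs = operand_function cs ` {a. operand_ok X (length cs) a}"

text \<open>A new instruction is appended at the end, so the numbers and contents of earlier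
  registers do not change; its own result sits in register \<open>length cs\<close>.\<close>

lemma available_snoc:
  assumes "instrs_ok X cs" "\<forall>a \<in> instr_operands c. operand_ok X (length cs) a"
  shows "instrs_ok X (cs @ [c])"
    and "insert (\<lambda>inp. instr_value inp (run_instrs inp cs []) c) (available X cs)
      \<subseteq> available X (cs @ [c])"
proof -
  show "instrs_ok X (cs @ [c])"
    using assms by (auto simp: instrs_ok_def nth_append less_Suc_eq)
  have "operand_function cs a \<in> available X (cs @ [c])" if "operand_ok X (length cs) a" for a
  proof -
    have "operand_function cs a = operand_function (cs @ [c]) a"
      using that by (cases a) (auto simp: operand_function_def run_instrs_append nth_append)
    moreover have "operand_ok X (length (cs @ [c])) a"
      using that by (cases a) auto
    ultimately show ?thesis
      unfolding available_def by blast
  qed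
  moreover have "operand_function (cs @ [c]) (Reg (length cs)) \<in> available X (cs @ [c])"
    unfolding available_def by (intro imageI) simp
  moreover have "operand_function (cs @ [c]) (Reg (length cs))
      = (\<lambda>inp. instr_value inp (run_instrs inp cs []) c)"
    by (auto simp: operand_function_def run_instrs_append nth_append)
  ultimately show "insert (\<lambda>inp. instr_value inp (run_instrs inp cs []) c) (available X cs)
      \<subseteq> available X (cs @ [c])"
    by (auto simp: available_def)
qed

text \<open>Each \<open>step\<close> of the derivation turns into one instruction. The invariant is
  that all of \<open>F\<close> is available after the instructions emitted so far.\<close>

lemma generates_imp_instrs:
  assumes "generates F n H" "instrs_ok X cs" "F \<subseteq> available X cs"
  shows "\<exists>ds. length ds \<le> n \<and> instrs_ok X (cs @ ds) \<and> H \<subseteq> available X (cs @ ds)"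
  using assms
proof (induction arbitrary: cs rule: generates.induct)
  case (base H F n)
  then show ?case by (intro exI[of _ "[]"]) auto
next
  case (step f F g h n H)
  from step.hyps(1,2) step.prems(2) obtain a b
    where a: "operand_ok X (length cs) a" "f = operand_function cs a"
      and b: "operand_ok X (length cs) b" "g = operand_function cs b"
    unfolding available_def by blast
  from step.hyps(3) a(2) b(2)
  have "\<exists>c\<in>{Add a b, Sub a b, Mul a b}. h = (\<lambda>inp. instr_value inp (run_instrs inp cs []) c)"
    by (auto simp: operand_function_def fun_eq_iff)
  then obtain c where c: "c \<in> {Add a b, Sub a b, Mul a b}"
      "h = (\<lambda>inp. instr_value inp (run_instrs inp cs []) c)" ..
  have "\<forall>x \<in> instr_operands c. operand_ok X (length cs) x"
    using a b c(1) by auto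
  note snoc = available_snoc[OF step.prems(1) this, folded c(2)]
  have "insert h F \<subseteq> available X (cs @ [c])"
    using step.prems(2) snoc(2) by blast
  from step.IH[OF snoc(1) this] obtain ds
    where "length ds \<le> n" "instrs_ok X ((cs @ [c]) @ ds)" "H \<subseteq> available X ((cs @ [c]) @ ds)"
    by blast
  then show ?case
    by (intro exI[of _ "c # ds"]) auto
qed

lemma generates_imp_program:
  assumes "generates (range (\<lambda>c inp. of_rat c) \<union> (\<lambda>x inp. inp x) ` X) n {f}"
  shows "\<exists>p. program_ok X p \<and> num_operations p \<le> n \<and> (\<forall>inp. program_value inp p = f inp)"
proof -
  have "range (\<lambda>c inp. of_rat c) = operand_function [] ` range Const"
    "(\<lambda>x inp. inp x) ` X = operand_function [] ` Input ` X"
    by (simp_all add: operand_function_def image_image)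
  moreover have "range Const \<union> Input ` X \<subseteq> {a. operand_ok X (length []) a}"
    by auto
  ultimately have "range (\<lambda>c inp. of_rat c) \<union> (\<lambda>x inp. inp x) ` X \<subseteq> available X []"
    unfolding available_def by blast
  from generates_imp_instrs[OF assms _ this] obtain ds
    where ds: "length ds \<le> n" "instrs_ok X ds" "f \<in> available X ds"
    by (auto simp: instrs_ok_def)
  then obtain a where "operand_ok X (length ds) a" "f = operand_function ds a"
    unfolding available_def by blast
  with ds(1,2) show ?thesis
    by (intro exI[of _ "Program ds a"])
      (auto simp: program_ok_def instrs_ok_def num_operations_def program_value_def
        operand_function_def)
qed

lemma sum_fun_apply: "(\<Sum>i\<in>I. h i) x = (\<Sum>i\<in>I. h i x)"
  for h :: "'i \<Rightarrow> 'b \<Rightarrow> 'c::comm_ring_1"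
  by (induction I rule: infinite_finite_induct) auto

lemma prod_fun_apply: "(\<Prod>i\<in>I. h i) x = (\<Prod>i\<in>I. h i x)"
  for h :: "'i \<Rightarrow> 'b \<Rightarrow> 'c::comm_ring_1"
  by (induction I rule: infinite_finite_induct) auto

section \<open>Recurrence for sums over acyclic digraphs\<close>

text \<open>No arc leaves \<open>R\<close>, so a path ending outside \<open>R\<close> never visits
  \<open>R\<close> and uses arcs of \<open>D\<close> only. Every vertex of a cycle has an outgoing
  arc, so a cycle avoids \<open>R\<close> and would already be a cycle of \<open>D\<close>.\<close>

lemma acyclic_Un_into_sinks:
  assumes "acyclic D" "Domain D \<inter> R = {}" "Domain E \<inter> R = {}" "Range E \<subseteq> R"
  shows "acyclic (D \<union> E)"
proof (rule acyclicI, intro allI notI)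
  have D: "(x, y) \<in> (D \<union> E)\<^sup>+ \<Longrightarrow> y \<notin> R \<Longrightarrow> (x, y) \<in> D\<^sup>+" for x y
  proof (induction rule: trancl_induct)
    case (base y)
    with assms(4) show ?case by auto
  next
    case (step y z)
    from step.hyps(2) assms(2,3) have "y \<notin> R" by auto
    with step assms(4) show ?case by (auto intro: trancl_into_trancl)
  qed
  fix x assume x: "(x, x) \<in> (D \<union> E)\<^sup>+"
  then have "x \<in> Domain (D \<union> E)"
    by (metis Domain.DomainI tranclD)
  with assms(2,3) have "x \<notin> R" by auto
  with D[OF x] assms(1) show False by (auto simp: acyclic_def)
qed

lemma finite_acyclic_digraphs [simp]: "finite V \<Longrightarrow> finite (acyclic_digraphs V)"
  unfolding acyclic_digraphs_def
  by (rule finite_subset[of _ "Pow (V \<times> V)"]) auto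

definition zeta :: "('a set \<Rightarrow> 'r::comm_ring_1) \<Rightarrow> 'a set \<Rightarrow> 'r" where
  "zeta g S = (\<Sum>X\<in>Pow S. g X)"

text \<open>An acyclic digraph in which all of \<open>R\<close> are sinks is an acyclic digraph on
  \<open>T - R\<close> together with an independent choice of in-neighbours within
  \<open>T - R\<close> for each element of \<open>R\<close>. Summing over these choices factors into
  a product of zeta transforms.\<close>

lemma sum_acyclic_digraphs_sinks:
  assumes "finite T" "R \<subseteq> T"
  shows "(\<Sum>D | D \<in> acyclic_digraphs T \<and> Domain D \<inter> R = {}. \<Prod>i\<in>T. w i (in_neighbours D i))
    = weighted_dag_sum (T - R) w * (\<Prod>i\<in>R. zeta (w i) (T - R))"
proof -
  define S where "S = T - R"
  have fin: "finite S" "finite R" and T: "T = S \<union> R" "S \<inter> R = {}"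
    using assms by (auto simp: S_def finite_subset)
  let ?P = "PiE R (\<lambda>_. Pow S)"
  let ?L = "{D \<in> acyclic_digraphs T. Domain D \<inter> R = {}}"
  \<comment> \<open>\<open>join\<close> and \<open>split\<close> are mutually inverse: a digraph is
    separated into its arcs inside \<open>S\<close> and the in-neighbourhoods of \<open>R\<close>,
    the latter as an extensional function so that it lies in \<open>?P\<close>.\<close>
  define join :: "('a \<times> 'a) set \<times> ('a \<Rightarrow> 'a set) \<Rightarrow> ('a \<times> 'a) set"
    where "join = (\<lambda>(D, g). D \<union> {(j, i). i \<in> R \<and> j \<in> g i})"
  define split where "split = (\<lambda>D. (D \<inter> S \<times> S, restrict (in_neighbours D) R))"
  have in_S: "in_neighbours (D \<inter> S \<times> S) i = in_neighbours D i"
    if "D \<in> ?L" "i \<in> S" for D i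
    using that T by (fastforce simp: in_neighbours_def acyclic_digraphs_def)
  have "(\<Sum>D\<in>?L. \<Prod>i\<in>T. w i (in_neighbours D i))
      = (\<Sum>(D, g)\<in>acyclic_digraphs S \<times> ?P.
          (\<Prod>i\<in>S. w i (in_neighbours D i)) * (\<Prod>i\<in>R. w i (g i)))"
  proof (rule sum.reindex_bij_witness[of _ join split])
    fix D assume D: "D \<in> ?L"
    then have sub: "D \<subseteq> T \<times> T" and ac: "acyclic D" and dom: "Domain D \<inter> R = {}"
      by (auto simp: acyclic_digraphs_def)
    show "join (split D) = D"
      using sub dom T by (fastforce simp: join_def split_def in_neighbours_def)
    have "D \<subseteq> S \<times> T"
      using sub dom T by fastforce
    then show "split D \<in> acyclic_digraphs S \<times> ?P"
      using ac by (auto simp: split_def acyclic_digraphs_def in_neighbours_def intro: acyclic_subset)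
    show "(case split D of (D, g) \<Rightarrow>
        (\<Prod>i\<in>S. w i (in_neighbours D i)) * (\<Prod>i\<in>R. w i (g i)))
      = (\<Prod>i\<in>T. w i (in_neighbours D i))"
      using fin T in_S[OF D] by (simp add: split_def prod.union_disjoint)
  next
    fix Dg assume "Dg \<in> acyclic_digraphs S \<times> ?P"
    then obtain D g where Dg: "Dg = (D, g)" "D \<subseteq> S \<times> S" "acyclic D" "g \<in> ?P"
      by (auto simp: acyclic_digraphs_def)
    have sub: "{(j, i). i \<in> R \<and> j \<in> g i} \<subseteq> S \<times> R"
      using Dg(4) by auto
    have "acyclic (join Dg)"
      unfolding Dg(1) join_def prod.case
      by (rule acyclic_Un_into_sinks[where R = R]) (use sub Dg(2,3) T in auto)
    then show "join Dg \<in> ?L"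
      unfolding Dg(1) join_def acyclic_digraphs_def using sub Dg(2) T by auto
    have "D \<inter> S \<times> S = D"
      using Dg(2) by auto
    moreover have "restrict (in_neighbours (join Dg)) R = g"
      using Dg T by (auto simp: join_def in_neighbours_def restrict_def PiE_def extensional_def fun_eq_iff)
    ultimately show "split (join Dg) = Dg"
      unfolding Dg(1) using sub T(2) by (auto simp: join_def split_def)
  qed
  also have "\<dots> = weighted_dag_sum S w * (\<Sum>g\<in>?P. \<Prod>i\<in>R. w i (g i))"
    by (simp add: weighted_dag_sum_def sum_product sum.cartesian_product)
  also have "(\<Sum>g\<in>?P. \<Prod>i\<in>R. w i (g i)) = (\<Prod>i\<in>R. zeta (w i) S)"
    unfolding zeta_def using fin by (subst prod_sum_PiE) auto
  finally show ?thesis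
    unfolding S_def .
qed

section \<open>Inclusion-exclusion over the sinks\<close>

definition sinks :: "'a set \<Rightarrow> ('a \<times> 'a) set \<Rightarrow> 'a set" where
  "sinks T D = T - Domain D"

text \<open>The converse of a finite acyclic relation is well-founded, and a minimal element of
  \<open>T\<close> for the converse has no outgoing arc.\<close>

lemma acyclic_digraph_sinks_nonempty:
  assumes "finite T" "T \<noteq> {}" "D \<in> acyclic_digraphs T"
  shows "sinks T D \<noteq> {}"
proof -
  have D: "D \<subseteq> T \<times> T" "acyclic D"
    using assms(3) by (auto simp: acyclic_digraphs_def)
  then have "wf (D\<inverse>)"
    using assms(1) by (meson finite_SigmaI finite_acyclic_wf_converse finite_subset)
  with assms(2) obtain z where "z \<in> T" "\<And>y. (y, z) \<in> D\<inverse> \<Longrightarrow> y \<notin> T"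
    by (metis wf_eq_minimal ex_in_conv)
  with D(1) have "z \<in> sinks T D"
    by (auto simp: sinks_def)
  then show ?thesis by auto
qed

text \<open>The sum is the expansion of the product of \<open>-1 + 1\<close> over the elements of
  \<open>A\<close>.\<close>

lemma sum_Pow_neg_one_power:
  assumes "finite A" "A \<noteq> {}"
  shows "(\<Sum>R\<in>Pow A. (-1) ^ card R) = (0::'r::comm_ring_1)"
proof -
  have "(\<Sum>R\<in>Pow A. (\<Prod>i\<in>R. - 1 :: 'r) * (\<Prod>i\<in>A - R. 1)) = (\<Prod>i\<in>A. -1 + 1)"
    by (rule prod_add[OF assms(1), symmetric])
  with assms show ?thesis by (simp add: power_0_left)
qed

definition multi_subset_transform ::
    "('a set \<Rightarrow> 'r::comm_ring_1) \<Rightarrow> ('a \<Rightarrow> 'a set \<Rightarrow> 'r) \<Rightarrow> 'a set \<Rightarrow> 'r" where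
  "multi_subset_transform a f T = (\<Sum>S\<in>Pow T. a S * (\<Prod>i\<in>T - S. f i S))"

text \<open>With \<open>R = T - S\<close> the sum runs over pairs of a digraph \<open>D\<close> and
  a set \<open>R\<close> of sinks of \<open>D\<close>, with sign \<open>(-1) ^ card R\<close>. For
  fixed \<open>D\<close> these signs sum to zero because \<open>D\<close> has a sink.\<close>

lemma weighted_dag_sum_recurrence:
  assumes "finite T" "T \<noteq> {}"
  shows "multi_subset_transform (\<lambda>S. weighted_dag_sum S w) (\<lambda>i S. - zeta (w i) S) T = 0"
proof -
  let ?W = "\<lambda>D. \<Prod>i\<in>T. w i (in_neighbours D i)"
  have "multi_subset_transform (\<lambda>S. weighted_dag_sum S w) (\<lambda>i S. - zeta (w i) S) T
      = (\<Sum>R\<in>Pow T. (-1) ^ card R * (weighted_dag_sum (T - R) w * (\<Prod>i\<in>R. zeta (w i) (T - R))))"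
    unfolding multi_subset_transform_def
    by (rule sum.reindex_bij_witness[of _ "\<lambda>R. T - R" "\<lambda>S. T - S"])
      (auto simp: prod_uminus double_diff)
  also have "\<dots> = (\<Sum>R\<in>Pow T. \<Sum>D\<in>acyclic_digraphs T.
      if Domain D \<inter> R = {} then (-1) ^ card R * ?W D else 0)"
    using assms(1)
    by (intro sum.cong refl, subst sum_acyclic_digraphs_sinks[symmetric])
      (auto simp: sum_distrib_left sum.inter_filter intro!: sum.cong)
  also have "\<dots> = (\<Sum>D\<in>acyclic_digraphs T. \<Sum>R\<in>Pow T.
      if Domain D \<inter> R = {} then (-1) ^ card R * ?W D else 0)"
    by (rule sum.swap)
  also have "\<dots> = (\<Sum>D\<in>acyclic_digraphs T. (\<Sum>R\<in>Pow (sinks T D). (-1) ^ card R) * ?W D)"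
  proof (rule sum.cong[OF refl])
    fix D
    have "{R \<in> Pow T. Domain D \<inter> R = {}} = Pow (sinks T D)"
      by (auto simp: sinks_def)
    then show "(\<Sum>R\<in>Pow T. if Domain D \<inter> R = {} then (-1) ^ card R * ?W D else 0)
        = (\<Sum>R\<in>Pow (sinks T D). (-1) ^ card R) * ?W D"
      using assms(1) by (simp add: sum.inter_filter[symmetric] sum_distrib_right)
  qed
  also have "\<dots> = 0"
  proof (rule sum.neutral, rule ballI)
    fix D assume "D \<in> acyclic_digraphs T"
    then show "(\<Sum>R\<in>Pow (sinks T D). (-1) ^ card R) * ?W D = 0"
      using assms acyclic_digraph_sinks_nonempty[OF assms]
      by (subst sum_Pow_neg_one_power) (auto simp: sinks_def)
  qed
  finally show ?thesis .
qed

section \<open>Solving the recurrence by iteration\<close>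

lemma weighted_dag_sum_empty [simp]: "weighted_dag_sum {} w = 1"
proof -
  have "acyclic_digraphs ({} :: 'a set) = {{}}"
    by (auto simp: acyclic_digraphs_def acyclic_def)
  then show ?thesis by (simp add: weighted_dag_sum_def)
qed

text \<open>Each round updates all sets \<open>T\<close> simultaneously, so that it needs the
  transform as a whole and can use a fast algorithm for it.\<close>

fun dag_iterate :: "('a \<Rightarrow> 'a set \<Rightarrow> 'r::comm_ring_1) \<Rightarrow> nat \<Rightarrow> 'a set \<Rightarrow> 'r" where
  "dag_iterate f 0 T = (if T = {} then 1 else 0)"
| "dag_iterate f (Suc m) T =
     (if T = {} then 1
      else dag_iterate f m T - multi_subset_transform (dag_iterate f m) f T)"

text \<open>The summand \<open>S = T\<close> of the transform is \<open>a T\<close> times an empty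
  product. It cancels in the update, which therefore depends on proper subsets of \<open>T\<close>
  only; each round makes the values correct for one more cardinality.\<close>

lemma dag_iterate_eq:
  assumes "b {} = 1"
    and "\<And>T. finite T \<Longrightarrow> T \<noteq> {} \<Longrightarrow> multi_subset_transform b f T = 0"
    and "finite T" "card T \<le> m"
  shows "dag_iterate f m T = b T"
  using assms(3,4)
proof (induction m arbitrary: T)
  case (Suc m)
  show ?case
  proof (cases "T = {}")
    case False
    have split: "multi_subset_transform a f T
        = a T + (\<Sum>S\<in>Pow T - {T}. a S * (\<Prod>i\<in>T - S. f i S))" for a
      unfolding multi_subset_transform_def using Suc.prems(1)
      by (subst sum.remove[of _ T]) auto
    have "dag_iterate f m S = b S" if "S \<in> Pow T - {T}" for S
    proof -
      have "S \<subset> T" using that by auto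
      then have "card S < card T" "finite S"
        using Suc.prems(1) by (auto simp: psubset_card_mono finite_subset)
      with Suc show ?thesis by auto
    qed
    then have "dag_iterate f (Suc m) T = - (\<Sum>S\<in>Pow T - {T}. b S * (\<Prod>i\<in>T - S. f i S))"
      using False by (simp add: split)
    also have "\<dots> = b T"
      using assms(2)[OF Suc.prems(1) False] by (simp add: split add_eq_0_iff)
    finally show ?thesis .
  qed (simp add: assms(1))
qed (use assms(1) in auto)

section \<open>Tensor powers of bilinear schemes\<close>

text \<open>The base tensor has one term per \<open>p\<close>, which multiplies coordinates
  \<open>\<alpha> p\<close> and \<open>\<beta> p\<close> and adds the result to coordinate
  \<open>\<gamma> p\<close>. Vectors for its \<open>k\<close>-th power are indexed by words of
  length \<open>k\<close>.\<close>

fun tensor_power ::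
    "('p::finite \<Rightarrow> 'i) \<Rightarrow> ('p \<Rightarrow> 'j) \<Rightarrow> ('p \<Rightarrow> 'l) \<Rightarrow>
     ('i list \<Rightarrow> 'r::comm_ring_1) \<Rightarrow> ('j list \<Rightarrow> 'r) \<Rightarrow> 'l list \<Rightarrow> 'r" where
  "tensor_power \<alpha> \<beta> \<gamma> A B [] = A [] * B []"
| "tensor_power \<alpha> \<beta> \<gamma> A B (x # l) =
     (\<Sum>p\<in>UNIV. if \<gamma> p = x
       then tensor_power \<alpha> \<beta> \<gamma> (\<lambda>u. A (\<alpha> p # u)) (\<lambda>v. B (\<beta> p # v)) l else 0)"

lemma finite_words: "finite {u :: 'i::finite list. length u = k}"
  using finite_lists_length_eq[of "UNIV :: 'i set" k] by simp

text \<open>Unrolling the recursion chooses one term of the base tensor per letter. This closed form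
  yields bilinearity and the comparison with the multi-subset transform.\<close>

lemma tensor_power_eq_sum:
  fixes \<alpha> :: "'p::finite \<Rightarrow> 'i"
  shows "tensor_power \<alpha> \<beta> \<gamma> A B l = (\<Sum>u | map \<gamma> u = l. A (map \<alpha> u) * B (map \<beta> u))"
proof (induction l arbitrary: A B)
  case (Cons x l)
  have fin: "finite {u. map \<gamma> u = l}"
    by (rule finite_subset[OF _ finite_words[of "length l"]]) auto
  have "{u. map \<gamma> u = x # l} = (\<lambda>(p, u). p # u) ` ({p. \<gamma> p = x} \<times> {u. map \<gamma> u = l})"
    by (auto simp: map_eq_Cons_conv)
  then have "(\<Sum>u | map \<gamma> u = x # l. A (map \<alpha> u) * B (map \<beta> u))
      = (\<Sum>(p, u)\<in>{p. \<gamma> p = x} \<times> {u. map \<gamma> u = l}.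
          A (\<alpha> p # map \<alpha> u) * B (\<beta> p # map \<beta> u))"
    by (simp add: sum.reindex inj_on_def case_prod_unfold)
  also have "\<dots> = (\<Sum>p | \<gamma> p = x. \<Sum>u | map \<gamma> u = l.
      A (\<alpha> p # map \<alpha> u) * B (\<beta> p # map \<beta> u))"
    by (simp add: sum.cartesian_product)
  also have "\<dots> = tensor_power \<alpha> \<beta> \<gamma> A B (x # l)"
    by (simp add: Cons.IH sum.inter_filter[of "UNIV :: 'p set", simplified] cong: if_cong)
  finally show ?case ..
qed (simp add: map_eq_conv)

lemma tensor_power_sum_left:
  "tensor_power \<alpha> \<beta> \<gamma> (\<lambda>u. \<Sum>i\<in>I. c i * A i u) B l
    = (\<Sum>i\<in>I. c i * tensor_power \<alpha> \<beta> \<gamma> (A i) B l)"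
  unfolding tensor_power_eq_sum sum_distrib_left sum_distrib_right
  by (subst sum.swap) (simp add: mult.assoc)

lemma tensor_power_sum_right:
  "tensor_power \<alpha> \<beta> \<gamma> A (\<lambda>u. \<Sum>i\<in>I. c i * B i u) l
    = (\<Sum>i\<in>I. c i * tensor_power \<alpha> \<beta> \<gamma> A (B i) l)"
  unfolding tensor_power_eq_sum sum_distrib_left
  by (subst sum.swap) (simp add: mult.left_commute)

section \<open>Cost of evaluating a tensor power\<close>

lemma card_words: "card {u :: 'i::finite list. length u = k} = CARD('i) ^ k"
  using card_lists_length_eq[of "UNIV :: 'i set" k] by simp

definition sign_constants :: "'r::comm_ring_1 set" where
  "sign_constants = {0, 1, - 1}"

lemma generates_signed_sum:
  assumes "finite I" "sign_constants \<subseteq> F"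
    and "\<And>i. i \<in> I \<Longrightarrow> h i \<in> F" "\<And>i. i \<in> I \<Longrightarrow> c i \<in> {-1, 0, 1 :: int}"
  shows "generates F (card I * 2) {\<Sum>i\<in>I. of_int (c i) * h i}"
proof -
  have "generates F (card I * Suc 1) {\<Sum>i\<in>I. of_int (c i) * h i}"
  proof (rule generates_sum[OF assms(1)])
    show "0 \<in> F"
      using assms(2) by (auto simp: sign_constants_def)
    fix i assume "i \<in> I"
    with assms(2,3) assms(4)[of i] have "of_int (c i) \<in> F" "h i \<in> F"
      by (auto simp: sign_constants_def)
    then have "generates F (Suc (0 + 0)) {of_int (c i) * h i}"
      by (intro generates_op[of F 0 "of_int (c i)" 0 "h i"]) (auto intro: generates.base)
    then show "generates F 1 {of_int (c i) * h i}"
      by simp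
  qed
  then show ?thesis by (simp add: numeral_2_eq_2)
qed

text \<open>The base tensor is written as a sum of \<open>card R\<close> tensors of rank one, so
  \<open>card R\<close> bounds its rank. Coefficients 0, 1 and -1 are free constants, and
  \<open>card_le\<close> keeps the linear combinations from outweighing the products.\<close>

locale bilinear_scheme =
  fixes \<alpha> :: "'p::finite \<Rightarrow> 'i::finite" and \<beta> :: "'p \<Rightarrow> 'j::finite" and \<gamma> :: "'p \<Rightarrow> 'l::finite"
    and R :: "'q set" and a :: "'q \<Rightarrow> 'i \<Rightarrow> int" and b :: "'q \<Rightarrow> 'j \<Rightarrow> int" and c :: "'q \<Rightarrow> 'l \<Rightarrow> int"
  assumes finite_R: "finite R"
    and signs: "a r i \<in> {-1, 0, 1}" "b r j \<in> {-1, 0, 1}" "c r l \<in> {-1, 0, 1}"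
    and decomposition:
      "(\<Sum>r\<in>R. a r i * b r j * c r l) = (\<Sum>p\<in>UNIV. if \<alpha> p = i \<and> \<beta> p = j \<and> \<gamma> p = l then 1 else 0)"
    and card_le: "CARD('i) \<le> card R" "CARD('j) \<le> card R" "CARD('l) \<le> card R"
begin

definition left :: "('i list \<Rightarrow> 'r::comm_ring_1) \<Rightarrow> 'q \<Rightarrow> 'i list \<Rightarrow> 'r" where
  "left A r u = (\<Sum>i\<in>UNIV. of_int (a r i) * A (i # u))"

definition right :: "('j list \<Rightarrow> 'r::comm_ring_1) \<Rightarrow> 'q \<Rightarrow> 'j list \<Rightarrow> 'r" where
  "right B r v = (\<Sum>j\<in>UNIV. of_int (b r j) * B (j # v))"

text \<open>Applying the rank decomposition to the first letter replaces one evaluation on words of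
  length \<open>k + 1\<close> by \<open>card R\<close> evaluations on words of length
  \<open>k\<close>, as in Strassen's recursive algorithm.\<close>

lemma tensor_power_Cons:
  "tensor_power \<alpha> \<beta> \<gamma> A B (x # l)
    = (\<Sum>r\<in>R. of_int (c r x) * tensor_power \<alpha> \<beta> \<gamma> (left A r) (right B r) l)"
proof -
  let ?t = "\<lambda>i j. tensor_power \<alpha> \<beta> \<gamma> (\<lambda>u. A (i # u)) (\<lambda>v. B (j # v)) l"
  have expand: "tensor_power \<alpha> \<beta> \<gamma> (left A r) (right B r) l
      = (\<Sum>i\<in>UNIV. \<Sum>j\<in>UNIV. of_int (a r i * b r j) * ?t i j)" for r
    unfolding left_def right_def tensor_power_sum_left tensor_power_sum_right
    by (simp add: sum_distrib_left mult.assoc)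
  have "(\<Sum>r\<in>R. of_int (c r x) * tensor_power \<alpha> \<beta> \<gamma> (left A r) (right B r) l)
      = (\<Sum>r\<in>R. \<Sum>i\<in>UNIV. \<Sum>j\<in>UNIV. of_int (a r i * b r j * c r x) * ?t i j)"
    unfolding expand sum_distrib_left by (simp add: mult_ac)
  also have "\<dots> = (\<Sum>i\<in>UNIV. \<Sum>j\<in>UNIV. \<Sum>r\<in>R. of_int (a r i * b r j * c r x) * ?t i j)"
    by (subst sum.swap) (intro sum.cong refl sum.swap)
  also have "\<dots> = (\<Sum>i\<in>UNIV. \<Sum>j\<in>UNIV. of_int (\<Sum>r\<in>R. a r i * b r j * c r x) * ?t i j)"
    by (simp add: sum_distrib_right)
  also have "\<dots> = (\<Sum>i\<in>UNIV. \<Sum>j\<in>UNIV. \<Sum>p\<in>UNIV.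
      if \<alpha> p = i \<and> \<beta> p = j \<and> \<gamma> p = x then ?t i j else 0)"
    unfolding decomposition of_int_sum sum_distrib_right by (intro sum.cong refl) simp
  also have "\<dots> = (\<Sum>p\<in>UNIV. \<Sum>i\<in>UNIV. \<Sum>j\<in>UNIV.
      if \<alpha> p = i \<and> \<beta> p = j \<and> \<gamma> p = x then ?t i j else 0)"
    by (subst (2) sum.swap, subst sum.swap) (rule refl)
  also have "\<dots> = (\<Sum>p\<in>UNIV. if \<gamma> p = x then ?t (\<alpha> p) (\<beta> p) else 0)"
  proof (rule sum.cong[OF refl])
    fix p
    have "(\<Sum>i\<in>UNIV. \<Sum>j\<in>UNIV. if \<alpha> p = i \<and> \<beta> p = j \<and> \<gamma> p = x then ?t i j else 0)
      = (\<Sum>i\<in>UNIV. if \<alpha> p = i then (\<Sum>j\<in>UNIV. if \<beta> p = j then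
            (if \<gamma> p = x then ?t i j else 0) else 0) else 0)"
      by (intro sum.cong refl) (auto intro: sum.cong)
    also have "\<dots> = (if \<gamma> p = x then ?t (\<alpha> p) (\<beta> p) else 0)"
      by simp
    finally show "(\<Sum>i\<in>UNIV. \<Sum>j\<in>UNIV. if \<alpha> p = i \<and> \<beta> p = j \<and> \<gamma> p = x then ?t i j else 0)
      = (if \<gamma> p = x then ?t (\<alpha> p) (\<beta> p) else 0)" .
  qed
  finally show ?thesis
    by simp
qed

text \<open>With \<open>q = card R\<close>, the cost satisfies
  \<open>t (k + 1) = q * t k + 6 * q ^ (k + 2)\<close>: preparing the two inputs of each of the
  \<open>q\<close> subproblems takes at most \<open>4 * q ^ (k + 1)\<close> operations, and
  recombining their results at most \<open>2 * q ^ (k + 2)\<close>.\<close>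

theorem generates_tensor_power:
  "generates (sign_constants \<union> A ` {u. length u = k} \<union> B ` {v. length v = k})
    ((1 + 6 * card R * k) * card R ^ k) (tensor_power \<alpha> \<beta> \<gamma> A B ` {l. length l = k})"
proof (induction k arbitrary: A B)
  case 0
  have "generates (sign_constants \<union> A ` {u. length u = 0} \<union> B ` {v. length v = 0}) (Suc (0 + 0)) {A [] * B []}"
    by (rule generates_op[of _ 0 "A []" 0 "B []"]) (auto intro: generates.base)
  then show ?case by simp
next
  case (Suc k)
  let ?q = "card R"
  let ?F = "sign_constants \<union> A ` {u. length u = Suc k} \<union> B ` {v. length v = Suc k}"
  let ?t = "\<lambda>r. tensor_power \<alpha> \<beta> \<gamma> (left A r) (right B r)"
  let ?H = "\<Union>r\<in>R. ?t r ` {l. length l = k}"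
  have one: "generates ?F (4 * ?q ^ Suc k + (1 + 6 * ?q * k) * ?q ^ k) (?t r ` {l. length l = k})" for r
  proof (rule generates_trans)
    have "generates ?F (card {u :: 'i list. length u = k} * (CARD('i) * 2)) (left A r ` {u. length u = k})"
      by (rule generates_image[OF finite_words], unfold left_def, rule generates_signed_sum)
        (use signs in auto)
    moreover have "generates ?F (card {u :: 'j list. length u = k} * (CARD('j) * 2)) (right B r ` {u. length u = k})"
      by (rule generates_image[OF finite_words], unfold right_def, rule generates_signed_sum)
        (use signs in auto)
    ultimately have "generates ?F (CARD('i) ^ k * (CARD('i) * 2) + CARD('j) ^ k * (CARD('j) * 2))
        (left A r ` {u. length u = k} \<union> right B r ` {u. length u = k})"
      unfolding card_words by (rule generates_Un)
    moreover have "CARD('i) ^ k * (CARD('i) * 2) + CARD('j) ^ k * (CARD('j) * 2) \<le> 4 * ?q ^ Suc k"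
      using power_mono[OF card_le(1), of "Suc k"] power_mono[OF card_le(2), of "Suc k"]
      by (simp add: mult_ac)
    ultimately show "generates ?F (4 * ?q ^ Suc k) (left A r ` {u. length u = k} \<union> right B r ` {u. length u = k})"
      by (rule generates_mono) simp
    show "generates (?F \<union> (left A r ` {u. length u = k} \<union> right B r ` {u. length u = k}))
        ((1 + 6 * ?q * k) * ?q ^ k) (?t r ` {l. length l = k})"
      by (rule generates_mono_left[OF Suc.IH]) auto
  qed
  have all: "generates ?F (?q * (4 * ?q ^ Suc k + (1 + 6 * ?q * k) * ?q ^ k)) ?H"
    by (rule generates_UN[OF finite_R one])
  have "generates (?F \<union> ?H) (card {l :: 'l list. length l = Suc k} * (?q * 2))
      (tensor_power \<alpha> \<beta> \<gamma> A B ` {l. length l = Suc k})"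
  proof (rule generates_image[OF finite_words])
    fix l :: "'l list" assume "l \<in> {l. length l = Suc k}"
    then obtain x l' where l: "l = x # l'" "length l' = k"
      by (cases l) auto
    show "generates (?F \<union> ?H) (?q * 2) {tensor_power \<alpha> \<beta> \<gamma> A B l}"
      unfolding l(1) tensor_power_Cons
      by (rule generates_signed_sum[OF finite_R]) (use l(2) signs in auto)
  qed
  from generates_trans[OF all this] show ?case
  proof (rule generates_mono)
    have "card {l :: 'l list. length l = Suc k} \<le> ?q ^ Suc k"
      unfolding card_words by (rule power_mono[OF card_le(3)]) simp
    then have "card {l :: 'l list. length l = Suc k} * (?q * 2) \<le> ?q ^ Suc k * (?q * 2)"
      by (rule mult_right_mono) simp
    then show "?q * (4 * ?q ^ Suc k + (1 + 6 * ?q * k) * ?q ^ k)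
        + card {l :: 'l list. length l = Suc k} * (?q * 2)
      \<le> (1 + 6 * ?q * Suc k) * ?q ^ Suc k"
      by (simp add: algebra_simps)
  qed simp
qed

end

section \<open>Triples of elements and Strassen's identity\<close>

text \<open>The position of an element relative to \<open>S \<subseteq> T\<close>: in \<open>S\<close>, in \<open>T - S\<close>, or not in \<open>T\<close>.\<close>

datatype state = Source | Target | Outside

lemma UNIV_state: "UNIV = {Source, Target, Outside}"
  using state.exhaust by auto

instance state :: finite
  by standard (simp add: UNIV_state)

lemma card_state [simp]: "CARD(state) = 3"
  by (simp add: UNIV_state)

type_synonym block = "state \<times> state \<times> state"

text \<open>
  The left factor carries the weights of the first element of a triple and the right factor those of
  the other two. Of the remaining elements a factor only sees whether they lie in \<open>S\<close>.
\<close>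

fun left_index :: "block \<Rightarrow> state \<times> bool \<times> bool" where
  "left_index (s, t, u) = (s, t = Source, u = Source)"

fun right_index :: "block \<Rightarrow> bool \<times> state \<times> state" where
  "right_index (s, t, u) = (s = Source, t, u)"

fun out_index :: "block \<Rightarrow> bool \<times> bool \<times> bool" where
  "out_index (s, t, u) = (s \<noteq> Outside, t \<noteq> Outside, u \<noteq> Outside)"

text \<open>The coefficients of Strassen's seven products of 2x2 matrices, numbered from 0:
  \<open>strassen_left\<close> and \<open>strassen_right\<close> form the factors, and
  \<open>strassen_out\<close> tells how a product enters the result. \<open>False\<close> selects
  the first row or column, \<open>True\<close> the second.\<close>

definition strassen_left :: "nat \<Rightarrow> bool \<Rightarrow> bool \<Rightarrow> int" where
  "strassen_left m i k =
    [[[1, 0], [0, 1]], [[0, 0], [1, 1]], [[1, 0], [0, 0]], [[0, 0], [0, 1]],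
     [[1, 1], [0, 0]], [[-1, 0], [1, 0]], [[0, 1], [0, -1]]] ! m ! of_bool i ! of_bool k"

definition strassen_right :: "nat \<Rightarrow> bool \<Rightarrow> bool \<Rightarrow> int" where
  "strassen_right m k j =
    [[[1, 0], [0, 1]], [[1, 0], [0, 0]], [[0, 1], [0, -1]], [[-1, 0], [1, 0]],
     [[0, 0], [0, 1]], [[1, 1], [0, 0]], [[0, 0], [1, 1]]] ! m ! of_bool k ! of_bool j"

definition strassen_out :: "nat \<Rightarrow> bool \<Rightarrow> bool \<Rightarrow> int" where
  "strassen_out m i j =
    [[[1, 0], [0, 1]], [[0, 0], [1, -1]], [[0, 1], [0, 1]], [[1, 0], [1, 0]],
     [[-1, 1], [0, 0]], [[0, 0], [0, 1]], [[1, 0], [0, 0]]] ! m ! of_bool i ! of_bool j"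

lemma lessThan_7: "{..<7} = {0, 1, 2, 3, 4, 5, 6 :: nat}"
  by auto

text \<open>These are the Brent equations for 2x2 matrix multiplication, checked for all 64 index
  combinations.\<close>

lemma strassen:
  "(\<Sum>m<7. strassen_left m i k * strassen_right m k' j * strassen_out m i' j')
    = (if i = i' \<and> k = k' \<and> j = j' then 1 else 0)"
  unfolding lessThan_7 by (cases i; cases k; cases k'; cases j; cases i'; cases j')
    (simp_all add: strassen_left_def strassen_right_def strassen_out_def)

lemma strassen_signs:
  assumes "m < 7"
  shows "strassen_left m i k \<in> {-1, 0, 1}" "strassen_right m k j \<in> {-1, 0, 1}"
    "strassen_out m i j \<in> {-1, 0, 1}"
proof -
  have "m \<in> {0, 1, 2, 3, 4, 5, 6}"
    using assms by auto
  then show "strassen_left m i k \<in> {-1, 0, 1}" "strassen_right m k j \<in> {-1, 0, 1}"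
    "strassen_out m i j \<in> {-1, 0, 1}"
    unfolding strassen_left_def strassen_right_def strassen_out_def
    by (cases i; cases j; cases k; auto)+
qed

text \<open>
  On these triples the row index says whether the first element is in \<open>T\<close>, the inner index whether
  the second one is in \<open>S\<close>, and the column index whether the third one is in \<open>T\<close>.
\<close>

definition strassen_blocks :: "block set" where
  "strassen_blocks = {Target, Outside} \<times> {Source, Target} \<times> {Target, Outside}"

text \<open>\<open>Inl p\<close> computes the single term \<open>p\<close> by a product of its own,
  and \<open>Inr m\<close> is Strassen's product number \<open>m\<close>. The guards make the latter
  vanish at indices that do not come from \<open>strassen_blocks\<close>.\<close>

fun left_coeff :: "block + nat \<Rightarrow> state \<times> bool \<times> bool \<Rightarrow> int" where
  "left_coeff (Inl p) i = (if left_index p = i then 1 else 0)"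
| "left_coeff (Inr m) (s, t, u) =
     (if m < 7 \<and> s \<noteq> Source \<and> \<not> u then strassen_left m (s = Target) t else 0)"

fun right_coeff :: "block + nat \<Rightarrow> bool \<times> state \<times> state \<Rightarrow> int" where
  "right_coeff (Inl p) j = (if right_index p = j then 1 else 0)"
| "right_coeff (Inr m) (s, t, u) =
     (if m < 7 \<and> \<not> s \<and> t \<noteq> Outside \<and> u \<noteq> Source
      then strassen_right m (t = Source) (u = Target) else 0)"

fun out_coeff :: "block + nat \<Rightarrow> bool \<times> bool \<times> bool \<Rightarrow> int" where
  "out_coeff (Inl p) l = (if out_index p = l then 1 else 0)"
| "out_coeff (Inr m) (s, t, u) = (if m < 7 \<and> t then strassen_out m s u else 0)"

definition products :: "(block + nat) set" where
  "products = Inl ` (- strassen_blocks) \<union> Inr ` {..<7}"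

text \<open>Of the 27 terms, eight are replaced by seven products:
  \<open>27 - 8 + 7 = 26\<close>.\<close>

lemma card_products: "card products = 26"
proof -
  have "card (- strassen_blocks) = 19"
    unfolding Compl_eq_Diff_UNIV
    by (subst card_Diff_subset) (simp_all add: strassen_blocks_def)
  then show ?thesis
    unfolding products_def by (subst card_Un_disjoint) (auto simp: card_image)
qed

lemma sum_strassen_blocks:
  "(\<Sum>p\<in>strassen_blocks. if left_index p = i \<and> right_index p = j \<and> out_index p = l then 1 else 0)
    = (\<Sum>m<7. left_coeff (Inr m) i * right_coeff (Inr m) j * out_coeff (Inr m) l)"
proof -
  obtain s t u where i: "i = (s, t, u)" by (cases i)
  obtain s' t' u' where j: "j = (s', t', u')" by (cases j)
  obtain x y z where l: "l = (x, y, z)" by (cases l)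
  let ?c = "s \<noteq> Source \<and> \<not> u \<and> \<not> s' \<and> t' \<noteq> Outside \<and> u' \<noteq> Source \<and> y"
  have "(\<Sum>m<7. left_coeff (Inr m) i * right_coeff (Inr m) j * out_coeff (Inr m) l)
      = (\<Sum>m<7. if ?c then strassen_left m (s = Target) t * strassen_right m (t' = Source) (u' = Target)
          * strassen_out m x z else 0)"
    unfolding i j l by (intro sum.cong refl) simp
  also have "\<dots> = (if ?c \<and> (s = Target) = x \<and> t = (t' = Source) \<and> (u' = Target) = z then 1 else 0)"
    by (cases ?c) (simp_all only: strassen simp_thms if_True if_False sum.neutral_const)
  \<comment> \<open>The left index determines the first state and the right index the other two, so
    \<open>(s, t', u')\<close> is the only block that can contribute.\<close>
  also have "\<dots> = (if (s, t', u') \<in> strassen_blocks \<and> left_index (s, t', u') = i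
      \<and> right_index (s, t', u') = j \<and> out_index (s, t', u') = l then 1 else 0)"
    unfolding i j l strassen_blocks_def by (cases s; cases t'; cases u') auto
  also have "\<dots> = (\<Sum>p\<in>strassen_blocks. if p = (s, t', u') then
      (if left_index p = i \<and> right_index p = j \<and> out_index p = l then 1 else 0) else 0)"
    by (subst sum.delta) simp_all
  also have "\<dots> = (\<Sum>p\<in>strassen_blocks.
      if left_index p = i \<and> right_index p = j \<and> out_index p = l then 1 else 0)"
    unfolding i j by (intro sum.cong refl) auto
  finally show ?thesis ..
qed

text \<open>The 19 products \<open>Inl p\<close> account for the terms outside
  \<open>strassen_blocks\<close>, Strassen's seven for those inside. The three index types have 12,
  18 and 8 elements, all at most 26.\<close>

interpretation block_scheme:
  bilinear_scheme left_index right_index out_index products left_coeff right_coeff out_coeff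
proof
  show "finite products"
    unfolding products_def by simp
  show "left_coeff r i \<in> {-1, 0, 1}" for r i
    by (cases "(r, i)" rule: left_coeff.cases)
      (auto dest: strassen_signs(1))
  show "right_coeff r j \<in> {-1, 0, 1}" for r j
    by (cases "(r, j)" rule: right_coeff.cases)
      (auto dest: strassen_signs(2))
  show "out_coeff r l \<in> {-1, 0, 1}" for r l
    by (cases "(r, l)" rule: out_coeff.cases)
      (auto dest: strassen_signs(3))
  fix i j l
  let ?d = "\<lambda>p. if left_index p = i \<and> right_index p = j \<and> out_index p = l then 1 else 0 :: int"
  let ?c = "\<lambda>r. left_coeff r i * right_coeff r j * out_coeff r l"
  have "(\<Sum>r\<in>products. ?c r) = (\<Sum>p\<in>- strassen_blocks. ?c (Inl p)) + (\<Sum>m<7. ?c (Inr m))"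
    unfolding products_def by (subst sum.union_disjoint) (auto simp: sum.reindex)
  also have "\<dots> = (\<Sum>p\<in>- strassen_blocks. ?d p) + (\<Sum>p\<in>strassen_blocks. ?d p)"
    unfolding sum_strassen_blocks by (auto intro!: sum.cong)
  also have "\<dots> = (\<Sum>p\<in>UNIV. ?d p)"
    by (subst sum.union_disjoint[symmetric]) auto
  finally show "(\<Sum>r\<in>products. ?c r) = (\<Sum>p\<in>UNIV. ?d p)" .
qed (simp_all add: card_products)

section \<open>The multi-subset transform\<close>

datatype coord = First | Second | Third

lemma UNIV_coord: "UNIV = {First, Second, Third}"
  using coord.exhaust by auto

instance coord :: finite
  by standard (simp add: UNIV_coord)

lemma card_coord [simp]: "CARD(coord) = 3"
  by (simp add: UNIV_coord)

fun component :: "coord \<Rightarrow> 's \<times> 's \<times> 's \<Rightarrow> 's" where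
  "component First (x, y, z) = x"
| "component Second (x, y, z) = y"
| "component Third (x, y, z) = z"

lemma component_eqI: "(\<And>d. component d p = component d q) \<Longrightarrow> p = q"
  by (cases p; cases q) (metis component.simps)

lemma component_coords [simp]: "component d (h First, h Second, h Third) = h d"
  by (cases d) auto

definition marked :: "(bool \<times> bool \<times> bool) list \<Rightarrow> (nat \<times> coord) set" where
  "marked l = {(n, d). n < length l \<and> component d (l ! n)}"

abbreviation positions :: "nat \<Rightarrow> (nat \<times> coord) set" where
  "positions k \<equiv> {..<k} \<times> UNIV"

lemma marked_subset: "marked l \<subseteq> positions (length l)"
  by (auto simp: marked_def)

lemma card_marked: "card (marked l) \<le> 3 * length l"
  using card_mono[OF _ marked_subset[of l]] by (simp add: card_cartesian_product mult.commute)

lemma finite_marked: "finite (marked l)"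
  by (rule finite_subset[OF marked_subset]) simp

lemma ex_marked:
  assumes "T \<subseteq> positions k"
  shows "\<exists>l. length l = k \<and> marked l = T"
  by (rule exI[of _ "map (\<lambda>n. ((n, First) \<in> T, (n, Second) \<in> T, (n, Third) \<in> T)) [0..<k]"])
    (use assms in \<open>auto simp: marked_def component_coords[where h = "\<lambda>d. (_, d) \<in> T"]\<close>)

fun left_source :: "state \<times> bool \<times> bool \<Rightarrow> bool \<times> bool \<times> bool" where
  "left_source (s, t, u) = (s = Source, t, u)"

fun left_target :: "state \<times> bool \<times> bool \<Rightarrow> bool \<times> bool \<times> bool" where
  "left_target (s, t, u) = (s = Target, False, False)"

fun right_source :: "bool \<times> state \<times> state \<Rightarrow> bool \<times> bool \<times> bool" where
  "right_source (s, t, u) = (s, t = Source, u = Source)"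

fun right_target :: "bool \<times> state \<times> state \<Rightarrow> bool \<times> bool \<times> bool" where
  "right_target (s, t, u) = (False, t = Target, u = Target)"

lemma component_left_source: "component d (left_source (left_index p)) \<longleftrightarrow> component d p = Source"
  and component_right_source: "component d (right_source (right_index p)) \<longleftrightarrow> component d p = Source"
  and component_out: "component d (out_index p) \<longleftrightarrow> component d p \<noteq> Outside"
  and component_left_target:
    "component d (left_target (left_index p)) \<longleftrightarrow> d = First \<and> component d p = Target"
  and component_right_target:
    "component d (right_target (right_index p)) \<longleftrightarrow> d \<noteq> First \<and> component d p = Target"
  by (cases p; cases d; auto)+

text \<open>An index word determines \<open>S\<close> completely, but \<open>T - S\<close> only at
  first coordinates (left) or at second and third coordinates (right). The two vectors share the
  product over \<open>T - S\<close> accordingly; the factor \<open>a S\<close> goes to the left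
  one.\<close>

definition left_entry ::
    "((nat \<times> coord) set \<Rightarrow> 'r::comm_ring_1) \<Rightarrow> (nat \<times> coord \<Rightarrow> (nat \<times> coord) set \<Rightarrow> 'r) \<Rightarrow>
     (state \<times> bool \<times> bool) list \<Rightarrow> 'r" where
  "left_entry a f u = a (marked (map left_source u)) *
     (\<Prod>q\<in>marked (map left_target u). f q (marked (map left_source u)))"

definition right_entry ::
    "(nat \<times> coord \<Rightarrow> (nat \<times> coord) set \<Rightarrow> 'r::comm_ring_1) \<Rightarrow>
     (bool \<times> state \<times> state) list \<Rightarrow> 'r" where
  "right_entry f u = (\<Prod>q\<in>marked (map right_target u). f q (marked (map right_source u)))"

definition sources :: "block list \<Rightarrow> (nat \<times> coord) set" where
  "sources u = {(n, d). n < length u \<and> component d (u ! n) = Source}"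

text \<open>Indices that stem from a common block word agree on \<open>S\<close>, and the targets
  seen by the two sides partition \<open>T - S\<close>.\<close>

lemma entries_product:
  assumes "map out_index u = l"
  shows "left_entry a f (map left_index u) * right_entry f (map right_index u)
    = a (sources u) * (\<Prod>q\<in>marked l - sources u. f q (sources u))"
proof -
  have src: "marked (map left_source (map left_index u)) = sources u"
    "marked (map right_source (map right_index u)) = sources u"
    by (auto simp: marked_def sources_def component_left_source component_right_source)
  have "marked l - sources u
      = marked (map left_target (map left_index u)) \<union> marked (map right_target (map right_index u))"
    unfolding assms[symmetric]
    by (auto simp: marked_def sources_def component_out component_left_target component_right_target)
      (metis state.exhaust)+
  moreover have "marked (map left_target (map left_index u))
      \<inter> marked (map right_target (map right_index u)) = {}"
    by (auto simp: marked_def component_left_target component_right_target)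
  ultimately show ?thesis
    unfolding left_entry_def right_entry_def src
    by (simp add: prod.union_disjoint finite_marked mult.assoc del: map_map)
qed

text \<open>For a fixed output word, the block words above it correspond bijectively to the subsets
  \<open>S\<close> of the encoded set \<open>T\<close>, through \<open>sources\<close>.\<close>

lemma tensor_power_entries:
  "tensor_power left_index right_index out_index (left_entry a f) (right_entry f) l
    = multi_subset_transform a f (marked l)"
proof -
  \<comment> \<open>\<open>st S\<close> labels each position by its state relative to
    \<open>S\<close> and \<open>T\<close>, and \<open>word S\<close> regroups the labels into
    triples; this inverts \<open>sources\<close>.\<close>
  define st where "st = (\<lambda>S q. if q \<in> S then Source else if q \<in> marked l then Target else Outside)"
  define word where "word = (\<lambda>S. map (\<lambda>n. (st S (n, First), st S (n, Second), st S (n, Third))) [0..<length l])"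
  have word: "component d (word S ! n) = st S (n, d)" if "n < length l" for S n d
    using that by (cases d) (auto simp: word_def)
  have len: "length (word S) = length l" for S
    by (simp add: word_def)
  have "tensor_power left_index right_index out_index (left_entry a f) (right_entry f) l
      = (\<Sum>u | map out_index u = l. a (sources u) * (\<Prod>q\<in>marked l - sources u. f q (sources u)))"
    unfolding tensor_power_eq_sum by (intro sum.cong refl entries_product) simp
  also have "\<dots> = multi_subset_transform a f (marked l)"
    unfolding multi_subset_transform_def
  proof (rule sum.reindex_bij_witness[of _ word sources])
    fix u assume "u \<in> {u. map out_index u = l}"
    then have u: "l = map out_index u" by auto
    show "word (sources u) = u"
    proof (rule nth_equalityI)
      fix n assume "n < length (word (sources u))"
      then have n: "n < length u" by (simp add: len u)
      show "word (sources u) ! n = u ! n"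
      proof (rule component_eqI)
        fix d
        have "component d (word (sources u) ! n) = st (sources u) (n, d)"
          using n u by (intro word) simp
        also have "\<dots> = component d (u ! n)"
          using n by (cases "component d (u ! n)") (auto simp: st_def sources_def marked_def u component_out)
        finally show "component d (word (sources u) ! n) = component d (u ! n)" .
      qed
    qed (simp add: len u)
    show "sources u \<in> Pow (marked l)"
      by (auto simp: sources_def marked_def u component_out)
  next
    fix S assume S: "S \<in> Pow (marked l)"
    then have S': "(n, d) \<in> S \<Longrightarrow> n < length l" for n d
      by (auto simp: marked_def)
    show "sources (word S) = S"
      using S' by (auto simp: sources_def len word st_def split: if_splits)
    have "map out_index (word S) = l"
    proof (rule nth_equalityI)
      fix n assume "n < length (map out_index (word S))"
      then have n: "n < length l" by (simp add: len)
      show "map out_index (word S) ! n = l ! n"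
      proof (rule component_eqI)
        fix d
        show "component d (map out_index (word S) ! n) = component d (l ! n)"
          using n S by (auto simp: len component_out word st_def marked_def)
      qed
    qed (simp add: len)
    then show "word S \<in> {u. map out_index u = l}" by simp
  qed simp
  finally show ?thesis .
qed

section \<open>Cost of the multi-subset transform\<close>

lemma generates_prod_marked:
  assumes "1 \<in> F" "\<And>q. q \<in> marked l \<Longrightarrow> h q \<in> F"
  shows "generates F (3 * length l) {\<Prod>q\<in>marked l. h q}"
  by (rule generates_mono[OF generates_prod[OF finite_marked assms] card_marked]) auto

lemma generates_transform_positions:
  fixes k :: nat
  defines "Q \<equiv> positions k"
  shows "generates (sign_constants \<union> a ` Pow Q \<union> (\<lambda>(i, S). f i S) ` weight_inputs Q)
    ((2 + 162 * k) * 26 ^ k) (multi_subset_transform a f ` Pow Q)"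
proof -
  let ?F = "sign_constants \<union> a ` Pow Q \<union> (\<lambda>(i, S). f i S) ` weight_inputs Q"
  \<comment> \<open>Only values of \<open>f\<close> at sets not containing its index are supplied,
    so each factor needs a proof that targets are not sources.\<close>
  have f: "f q (marked s) \<in> ?F"
    if "q \<in> marked t" "q \<notin> marked s" "length s = k" "length t = k" for q s t
    using that marked_subset[of s] marked_subset[of t]
    by (intro UnI2 image_eqI[of _ _ "(q, marked s)"]) (auto simp: Q_def weight_inputs_def)
  have one: "1 \<in> ?F" by (simp add: sign_constants_def)
  have "generates ?F (card {u :: (state \<times> bool \<times> bool) list. length u = k} * (3 * k + 1))
      (left_entry a f ` {u. length u = k})"
  proof (rule generates_image[OF finite_words])
    fix u :: "(state \<times> bool \<times> bool) list" assume u: "u \<in> {u. length u = k}"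
    let ?s = "map left_source u" and ?t = "map left_target u"
    have "component d (left_target p) \<Longrightarrow> \<not> component d (left_source p)" for d p
      by (cases p; cases d) auto
    then have "q \<notin> marked ?s" if "q \<in> marked ?t" for q
      using that unfolding marked_def by fastforce
    then have prod: "generates ?F (3 * length ?t) {\<Prod>q\<in>marked ?t. f q (marked ?s)}"
      using u by (intro generates_prod_marked one f[of _ ?t]) auto
    have "a (marked ?s) \<in> ?F"
      using u marked_subset[of ?s] by (auto simp: Q_def)
    then have "generates ?F 0 {a (marked ?s)}"
      by (intro generates.base) simp
    from generates_op[OF this prod] have "generates ?F (Suc (0 + 3 * length ?t)) {left_entry a f u}"
      unfolding left_entry_def by simp
    then show "generates ?F (3 * k + 1) {left_entry a f u}"
      using u by simp
  qed
  moreover have "generates ?F (card {u :: (bool \<times> state \<times> state) list. length u = k} * (3 * k))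
      (right_entry f ` {u. length u = k})"
  proof (rule generates_image[OF finite_words])
    fix u :: "(bool \<times> state \<times> state) list" assume u: "u \<in> {u. length u = k}"
    let ?s = "map right_source u" and ?t = "map right_target u"
    have "component d (right_target p) \<Longrightarrow> \<not> component d (right_source p)" for d p
      by (cases p; cases d) auto
    then have "q \<notin> marked ?s" if "q \<in> marked ?t" for q
      using that unfolding marked_def by fastforce
    then have "generates ?F (3 * length ?t) {\<Prod>q\<in>marked ?t. f q (marked ?s)}"
      using u by (intro generates_prod_marked one f[of _ ?t]) auto
    then show "generates ?F (3 * k) {right_entry f u}"
      using u by (simp add: right_entry_def)
  qed
  \<comment> \<open>A triple has \<open>12 = 3 * 2 * 2\<close> left and
    \<open>18 = 2 * 3 * 3\<close> right indices. Both numbers are below 26, so preparing the entries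
    does not affect the exponential rate.\<close>
  ultimately have entries: "generates ?F (12 ^ k * (3 * k + 1) + 18 ^ k * (3 * k))
      (left_entry a f ` {u. length u = k} \<union> right_entry f ` {u. length u = k})"
    unfolding card_words by (intro generates_Un) simp_all
  have "generates (?F \<union> (left_entry a f ` {u. length u = k} \<union> right_entry f ` {u. length u = k}))
      ((1 + 156 * k) * 26 ^ k)
      (tensor_power left_index right_index out_index (left_entry a f) (right_entry f) ` {l. length l = k})"
    using block_scheme.generates_tensor_power[of "left_entry a f" k "right_entry f"]
    by (auto simp: card_products elim!: generates_mono_left)
  from generates_trans[OF entries this] show ?thesis
  proof (rule generates_mono)
    have "12 ^ k * (3 * k + 1) + 18 ^ k * (3 * k) + (1 + 156 * k) * 26 ^ k
        \<le> 26 ^ k * (3 * k + 1) + 26 ^ k * (3 * k) + (1 + 156 * k) * 26 ^ k"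
      by (intro add_mono mult_right_mono power_mono order_refl) simp_all
    also have "\<dots> = (2 + 162 * k) * 26 ^ k"
      by (simp add: algebra_simps)
    finally show "12 ^ k * (3 * k + 1) + 18 ^ k * (3 * k) + (1 + 156 * k) * 26 ^ k
        \<le> (2 + 162 * k) * 26 ^ k" .
    show "multi_subset_transform a f ` Pow Q \<subseteq>
        tensor_power left_index right_index out_index (left_entry a f) (right_entry f) ` {l. length l = k}"
    proof (rule image_subsetI)
      fix T assume "T \<in> Pow Q"
      then obtain l where "length l = k" "marked l = T"
        using ex_marked[of T k] by (auto simp: Q_def)
      then show "multi_subset_transform a f T \<in>
          tensor_power left_index right_index out_index (left_entry a f) (right_entry f) ` {l. length l = k}"
        by (intro image_eqI[of _ _ l]) (simp_all add: tensor_power_entries)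
    qed
  qed
qed

text \<open>\<open>V\<close> is embedded injectively into the \<open>3 * k\<close> positions, and
  the transform on \<open>V\<close> is read off at the images of its subsets. Padding thus covers
  cardinalities not divisible by three.\<close>

theorem generates_multi_subset_transform:
  assumes "finite V" "card V \<le> 3 * k"
  shows "generates (sign_constants \<union> a ` Pow V \<union> (\<lambda>(i, S). f i S) ` weight_inputs V)
    ((2 + 162 * k) * 26 ^ k) (multi_subset_transform a f ` Pow V)"
proof -
  have "card V \<le> card (positions k)"
    using assms(2) by (simp add: card_cartesian_product mult.commute)
  then obtain \<iota> where \<iota>: "\<iota> ` V \<subseteq> positions k" "inj_on \<iota> V"
    using card_le_inj[OF assms(1)] by (metis finite_SigmaI finite_lessThan finite)
  define pull where "pull = (\<lambda>S. {v \<in> V. \<iota> v \<in> S})"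
  define e where "e = inv_into V \<iota>"
  define a' where "a' = (\<lambda>S. a (pull S))"
  \<comment> \<open>The default 0 is a free constant and extends \<open>f\<close> to all positions
    and sets, so that every value of \<open>f'\<close> lies in \<open>?F\<close>.\<close>
  define f' where "f' = (\<lambda>q S. if q \<in> \<iota> ` V \<and> q \<notin> S then f (e q) (pull S) else 0)"
  have e: "e (\<iota> v) = v" if "v \<in> V" for v
    using that \<iota>(2) by (simp add: e_def)
  have pull: "pull (\<iota> ` S) = S" if "S \<subseteq> V" for S
    using that \<iota>(2) by (auto simp: pull_def inj_on_def)
  have transform: "multi_subset_transform a' f' (\<iota> ` T) = multi_subset_transform a f T" if "T \<subseteq> V" for T
  proof -
    have inj: "inj_on \<iota> T"
      using \<iota>(2) that by (rule inj_on_subset)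
    have "multi_subset_transform a' f' (\<iota> ` T)
        = (\<Sum>S\<in>Pow T. a' (\<iota> ` S) * (\<Prod>q\<in>\<iota> ` T - \<iota> ` S. f' q (\<iota> ` S)))"
      unfolding multi_subset_transform_def image_Pow_surj[OF refl, symmetric]
      by (subst sum.reindex) (auto simp: inj_on_image_Pow inj)
    also have "\<dots> = (\<Sum>S\<in>Pow T. a S * (\<Prod>i\<in>T - S. f i S))"
    proof (intro sum.cong refl arg_cong2[where f = "(*)"])
      fix S assume S: "S \<in> Pow T"
      then have pull_S: "pull (\<iota> ` S) = S"
        using that by (intro pull) auto
      then show "a' (\<iota> ` S) = a S" by (simp add: a'_def)
      have "\<iota> ` T - \<iota> ` S = \<iota> ` (T - S)"
        using S by (subst inj_on_image_set_diff[OF inj]) auto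
      then have "(\<Prod>q\<in>\<iota> ` T - \<iota> ` S. f' q (\<iota> ` S)) = (\<Prod>i\<in>T - S. f' (\<iota> i) (\<iota> ` S))"
        by (simp add: prod.reindex inj_on_subset[OF inj])
      also have "\<dots> = (\<Prod>i\<in>T - S. f i S)"
      proof (rule prod.cong[OF refl])
        fix i assume i: "i \<in> T - S"
        then have "i \<in> V" "\<iota> i \<notin> \<iota> ` S"
          using S that inj by (auto dest: inj_onD)
        then show "f' (\<iota> i) (\<iota> ` S) = f i S"
          by (simp add: f'_def e pull_S)
      qed
      finally show "(\<Prod>q\<in>\<iota> ` T - \<iota> ` S. f' q (\<iota> ` S)) = (\<Prod>i\<in>T - S. f i S)" .
    qed
    finally show ?thesis by (simp add: multi_subset_transform_def)
  qed
  let ?Q = "positions k"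
  let ?F = "sign_constants \<union> a ` Pow V \<union> (\<lambda>(i, S). f i S) ` weight_inputs V"
  have "a' ` Pow ?Q \<subseteq> a ` Pow V"
    by (auto simp: a'_def pull_def)
  then have sub: "sign_constants \<union> a' ` Pow ?Q \<subseteq> ?F"
    by blast
  have f': "f' q S \<in> ?F" for q S
  proof (cases "q \<in> \<iota> ` V \<and> q \<notin> S")
    case True
    then obtain v where v: "v \<in> V" "q = \<iota> v" by auto
    with True have "f' q S = (\<lambda>(i, S). f i S) (v, pull S)" "(v, pull S) \<in> weight_inputs V"
      by (auto simp: f'_def e weight_inputs_def pull_def)
    then show ?thesis by (metis UnI2 image_eqI)
  qed (auto simp: f'_def sign_constants_def)
  have "(\<lambda>(i, S). f' i S) ` weight_inputs ?Q \<subseteq> ?F"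
  proof (rule image_subsetI)
    fix x :: "(nat \<times> coord) \<times> (nat \<times> coord) set"
    obtain q S where "x = (q, S)" by (cases x)
    then show "(case x of (i, S) \<Rightarrow> f' i S) \<in> ?F"
      by (simp only: prod.case f')
  qed
  with sub have "sign_constants \<union> a' ` Pow ?Q \<union> (\<lambda>(i, S). f' i S) ` weight_inputs ?Q \<subseteq> ?F"
    by (rule Un_least)
  from generates_mono_left[OF generates_transform_positions this] show ?thesis
  proof (rule generates_mono[OF _ order_refl])
    show "multi_subset_transform a f ` Pow V \<subseteq> multi_subset_transform a' f' ` Pow (positions k)"
    proof
      fix x assume "x \<in> multi_subset_transform a f ` Pow V"
      then obtain T where "T \<subseteq> V" "x = multi_subset_transform a f T" by auto
      then show "x \<in> multi_subset_transform a' f' ` Pow (positions k)"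
        using transform[of T] \<iota>(1) by (intro image_eqI[of _ _ "\<iota> ` T"]) auto
    qed
  qed
qed

section \<open>The algorithm and its cost\<close>

lemma zeta_insert:
  assumes "finite S" "x \<notin> S"
  shows "zeta g (insert x S) = zeta g S + zeta (\<lambda>X. g (insert x X)) S"
proof -
  have "inj_on (insert x) (Pow S)" "Pow S \<inter> insert x ` Pow S = {}"
    using assms(2) by (auto simp: inj_on_def)
  then show ?thesis
    using assms(1) unfolding zeta_def Pow_insert
    by (subst sum.union_disjoint) (simp_all add: sum.reindex)
qed

text \<open>Yates's method: splitting subsets by whether they contain \<open>x\<close> reduces the
  transform to two transforms on \<open>U\<close> and one addition for each subset of
  \<open>U\<close>.\<close>

lemma generates_zeta:
  assumes "finite U"
  shows "generates (g ` Pow U) (card U * 2 ^ card U) (zeta g ` Pow U)"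
  using assms
proof (induction U arbitrary: g rule: finite_induct)
  case empty
  then show ?case by (intro generates.base) (simp add: zeta_def)
next
  case (insert x U)
  let ?g = "\<lambda>X. g (insert x X)"
  let ?F = "g ` Pow (insert x U)" and ?H = "zeta g ` Pow U" and ?H' = "zeta ?g ` Pow U"
  have "generates ?F (card U * 2 ^ card U) ?H" "generates ?F (card U * 2 ^ card U) ?H'"
    by (rule generates_mono_left[OF insert.IH]; auto)+
  then have both: "generates ?F (card U * 2 ^ card U + card U * 2 ^ card U) (?H \<union> ?H')"
    by (rule generates_Un)
  let ?N = "(\<lambda>S. zeta g S + zeta ?g S) ` Pow U"
  have "generates (?F \<union> (?H \<union> ?H')) (card (Pow U) * 1) ?N"
  proof (rule generates_image)
    fix S assume "S \<in> Pow U"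
    then have "generates (?F \<union> (?H \<union> ?H')) (Suc (0 + 0)) {zeta g S + zeta ?g S}"
      by (intro generates_op[of _ 0 "zeta g S" 0 "zeta ?g S"]) (auto intro: generates.base)
    then show "generates (?F \<union> (?H \<union> ?H')) 1 {zeta g S + zeta ?g S}" by simp
  qed (use insert.hyps in simp)
  from generates_trans_Un[OF both this] show ?case
  proof (rule generates_mono)
    show "card U * 2 ^ card U + card U * 2 ^ card U + card (Pow U) * 1
        \<le> card (insert x U) * 2 ^ card (insert x U)"
      using insert.hyps by (simp add: card_Pow algebra_simps)
    have "zeta g (insert x S) = zeta g S + zeta ?g S" if "S \<subseteq> U" for S
      using that insert.hyps by (intro zeta_insert) (auto intro: finite_subset)
    then show "zeta g ` Pow (insert x U) \<subseteq> ?H \<union> ?H' \<union> ?N"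
      by (auto simp: Pow_insert)
  qed
qed

text \<open>A round consists of one transform and at most one subtraction per subset of
  \<open>V\<close>.\<close>

lemma generates_dag_iterate:
  assumes "finite V" "card V \<le> 3 * k" "sign_constants \<subseteq> F" "(\<lambda>(i, S). f i S) ` weight_inputs V \<subseteq> F"
  shows "generates F (m * ((2 + 162 * k) * 26 ^ k + 2 ^ card V)) (dag_iterate f m ` Pow V)"
proof (induction m)
  case 0
  have "dag_iterate f 0 ` Pow V \<subseteq> sign_constants"
    by (auto simp: sign_constants_def)
  then have "dag_iterate f 0 ` Pow V \<subseteq> F"
    using assms(3) by (rule subset_trans)
  then show ?case
    by (rule generates.base)
next
  case (Suc m)
  let ?M = "(2 + 162 * k) * 26 ^ k"
  let ?a = "dag_iterate f m" and ?b = "dag_iterate f (Suc m)"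
  let ?t = "multi_subset_transform ?a f"
  let ?F = "F \<union> (?a ` Pow V \<union> ?t ` Pow V)"
  have "generates (F \<union> ?a ` Pow V) ?M (?t ` Pow V)"
    by (rule generates_mono_left[OF generates_multi_subset_transform[OF assms(1,2)]])
      (use assms(3,4) in auto)
  then have t: "generates F (m * (?M + 2 ^ card V) + ?M) (?a ` Pow V \<union> ?t ` Pow V)"
    by (rule generates_trans_Un[OF Suc.IH])
  have "generates ?F (card (Pow V) * 1) (?b ` Pow V)"
  proof (rule generates_image)
    fix T assume T: "T \<in> Pow V"
    show "generates ?F 1 {?b T}"
    proof (cases "T = {}")
      case True
      have "1 \<in> ?F"
        using assms(3) by (auto simp: sign_constants_def)
      with True show ?thesis
        by (intro generates.base) simp
    next
      case False
      have "generates ?F (Suc (0 + 0)) {?a T - ?t T}"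
        using T by (intro generates_op[of _ 0 "?a T" 0 "?t T"]) (auto intro: generates.base)
      with False show ?thesis by simp
    qed
  qed (use assms(1) in simp)
  from generates_trans[OF t this] show ?case
    by (rule generates_mono) (use assms(1) in \<open>simp_all add: card_Pow algebra_simps\<close>)
qed

text \<open>The first summand pays, for each of \<open>n\<close> elements, a zeta transform and the
  negation of its values; the second pays \<open>n\<close> rounds of the iteration.
  \<open>(n + 2) div 3\<close> is \<open>n / 3\<close> rounded up.\<close>

definition operation_bound :: "nat \<Rightarrow> nat" where
  "operation_bound n =
    n * (n * 2 ^ n + 2 ^ n)
    + n * ((2 + 162 * ((n + 2) div 3)) * 26 ^ ((n + 2) div 3) + 2 ^ n)"

lemma ex_program:
  assumes "finite (V :: 'a set)"
  shows "\<exists>p. computes_weighted_dag_sum V p \<and> num_operations p \<le> operation_bound (card V)"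
proof -
  define n where "n = card V"
  define k where "k = (n + 2) div 3"
  \<comment> \<open>\<open>g i X\<close> is the function reading input \<open>(i, X)\<close>: the
    whole computation takes place in the function ring.\<close>
  define g :: "'a \<Rightarrow> 'a set \<Rightarrow> ('a \<times> 'a set \<Rightarrow> real) \<Rightarrow> real" where "g = (\<lambda>i X inp. inp (i, X))"
  define f where "f = (\<lambda>i S. - zeta (g i) S)"
  let ?F = "range (\<lambda>c inp. real_of_rat c) \<union> (\<lambda>x inp. inp x) ` weight_inputs V"
  have const: "sign_constants \<subseteq> ?F"
  proof -
    have "0 \<in> ?F"
      by (rule UnI1, rule range_eqI[of _ _ 0]) (simp add: fun_eq_iff)
    moreover have "1 \<in> ?F"
      by (rule UnI1, rule range_eqI[of _ _ 1]) (simp add: fun_eq_iff)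
    moreover have "- 1 \<in> ?F"
      by (rule UnI1, rule range_eqI[of _ _ "- 1"]) (simp add: fun_eq_iff of_rat_minus)
    ultimately show ?thesis
      unfolding sign_constants_def by blast
  qed
  have f: "generates ?F (n * (n * 2 ^ n + 2 ^ n)) ((\<lambda>(i, S). f i S) ` weight_inputs V)"
  proof -
    have "generates ?F (n * 2 ^ n + 2 ^ n) (f i ` Pow (V - {i}))" if i: "i \<in> V" for i
    proof -
      have card: "card (V - {i}) \<le> n"
        unfolding n_def using assms by (intro card_mono) auto
      have "g i ` Pow (V - {i}) \<subseteq> ?F"
        using i by (auto simp: g_def weight_inputs_def intro!: image_eqI)
      then have "generates ?F (card (V - {i}) * 2 ^ card (V - {i})) (zeta (g i) ` Pow (V - {i}))"
        using generates_zeta[of "V - {i}" "g i"] assms by (auto elim: generates_mono_left)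
      moreover have "generates (?F \<union> zeta (g i) ` Pow (V - {i})) (card (Pow (V - {i})) * 1) (f i ` Pow (V - {i}))"
      proof (rule generates_image)
        fix S assume "S \<in> Pow (V - {i})"
        \<comment> \<open>Negation is the single operation \<open>0 - zeta (g i) S\<close>.\<close>
        then have "generates (?F \<union> zeta (g i) ` Pow (V - {i})) (Suc (0 + 0)) {f i S}"
          using const by (intro generates_op[of _ 0 0 0 "zeta (g i) S"])
            (auto simp: f_def sign_constants_def intro!: generates.base)
        then show "generates (?F \<union> zeta (g i) ` Pow (V - {i})) 1 {f i S}" by simp
      qed (use assms in simp)
      ultimately have "generates ?F (card (V - {i}) * 2 ^ card (V - {i}) + card (Pow (V - {i})) * 1)
          (f i ` Pow (V - {i}))"
        by (rule generates_trans)
      then show ?thesis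
        by (rule generates_mono)
          (use card assms in \<open>auto simp: card_Pow intro!: add_mono mult_mono power_increasing\<close>)
    qed
    from generates_UN[OF assms this] show ?thesis
      by (rule generates_mono) (auto simp: n_def weight_inputs_def)
  qed
  have "generates (?F \<union> (\<lambda>(i, S). f i S) ` weight_inputs V)
      (n * ((2 + 162 * k) * 26 ^ k + 2 ^ card V)) (dag_iterate f n ` Pow V)"
    by (rule generates_dag_iterate[OF assms]) (use const in \<open>auto simp: n_def k_def\<close>)
  from generates_trans[OF f this]
  have "generates ?F (operation_bound n) {dag_iterate f n V}"
    by (rule generates_mono) (auto simp: operation_bound_def k_def n_def)
  from generates_imp_program[OF this] obtain p
    where p: "program_ok (weight_inputs V) p" "num_operations p \<le> operation_bound n"
      "\<And>inp. program_value inp p = dag_iterate f n V inp"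
    by blast
  \<comment> \<open>Identities in the function ring are checked pointwise; at each input assignment
    the recurrence is the one for real weights.\<close>
  define b where "b = (\<lambda>S inp. weighted_dag_sum S (\<lambda>i X. inp (i, X :: 'a set)))"
  have "dag_iterate f n V = b V"
  proof (rule dag_iterate_eq)
    show "b {} = 1"
      by (simp add: b_def fun_eq_iff)
    fix T :: "'a set" assume T: "finite T" "T \<noteq> {}"
    show "multi_subset_transform b f T = 0"
    proof
      fix inp
      have "f i S inp = - zeta (\<lambda>X. inp (i, X)) S" for i S
        by (simp add: f_def zeta_def g_def sum_fun_apply)
      then show "multi_subset_transform b f T inp = 0 inp"
        using weighted_dag_sum_recurrence[OF T, of "\<lambda>i X. inp (i, X)"]
        by (simp add: multi_subset_transform_def sum_fun_apply prod_fun_apply b_def)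
    qed
  qed (simp_all add: assms n_def)
  then have "computes_weighted_dag_sum V p"
    using p(1,3) by (simp add: computes_weighted_dag_sum_def b_def)
  with p(2) show ?thesis
    unfolding n_def by blast
qed

lemma operation_bound_le:
  "real (operation_bound n) \<le> (1459 * real n ^ 2 + 1478 * real n) * 2.963 ^ n"
proof -
  define k where "k = (n + 2) div 3"
  \<comment> \<open>\<open>2.963 ^ 3\<close> is about 26.013. Rounding up to \<open>k\<close>
    triples costs at most the factor \<open>2.963 ^ 2\<close>, which is below 9.\<close>
  have "(26::real) ^ k \<le> (2.963 ^ 3) ^ k"
    by (rule power_mono) (simp_all add: power3_eq_cube)
  also have "\<dots> = 2.963 ^ (3 * k)"
    by (simp add: power_mult)
  also have "\<dots> \<le> 2.963 ^ (n + 2)"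
    by (rule power_increasing) (auto simp: k_def)
  also have "\<dots> \<le> 9 * 2.963 ^ n"
    by (simp add: power_add power2_eq_square)
  finally have a: "(26::real) ^ k \<le> 9 * 2.963 ^ n" .
  have b: "(2::real) ^ n \<le> 2.963 ^ n"
    by (rule power_mono) simp_all
  have k: "real k \<le> real n + 1"
    by (auto simp: k_def)
  have "real (operation_bound n) = real n * (real n * 2 ^ n + 2 ^ n)
      + real n * ((2 + 162 * real k) * 26 ^ k + 2 ^ n)"
    unfolding operation_bound_def k_def[symmetric] by (simp add: distrib_right)
  also have "\<dots> \<le> real n * (real n * 2.963 ^ n + 2.963 ^ n)
      + real n * ((2 + 162 * (real n + 1)) * (9 * 2.963 ^ n) + 2.963 ^ n)"
    using a b k by (intro add_mono mult_mono mult_left_mono) auto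
  \<comment> \<open>\<open>1459 = 1 + 9 * 162\<close> and
    \<open>1478 = 1 + 9 * 164 + 1\<close>.\<close>
  also have "\<dots> = (1459 * real n ^ 2 + 1478 * real n) * 2.963 ^ n"
    by (simp add: algebra_simps power2_eq_square)
  finally show ?thesis .
qed

theorem theorem2:
  shows "\<exists>T :: nat \<Rightarrow> real. T \<in> O(\<lambda>n. 2.985 ^ n) \<and>
    (\<forall>V :: 'a set. finite V \<longrightarrow>
      (\<exists>p. computes_weighted_dag_sum V p \<and> real (num_operations p) \<le> T (card V)))"
proof (rule exI[of _ "\<lambda>n. (1459 * real n ^ 2 + 1478 * real n) * 2.963 ^ n"],
    intro conjI allI impI)
  show "(\<lambda>n. (1459 * real n ^ 2 + 1478 * real n) * 2.963 ^ n) \<in> O(\<lambda>n. 2.985 ^ n)"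
    \<comment> \<open>The quadratic factor is absorbed since \<open>2.963 < 2.985\<close>.\<close>
    by real_asymp
next
  fix V :: "'a set"
  assume "finite V"
  from ex_program[OF this] obtain p
    where "computes_weighted_dag_sum V p" "num_operations p \<le> operation_bound (card V)"
    by blast
  then show "\<exists>p. computes_weighted_dag_sum V p \<and> real (num_operations p)
      \<le> (1459 * real (card V) ^ 2 + 1478 * real (card V)) * 2.963 ^ card V"
    using operation_bound_le[of "card V"] by (intro exI[of _ p]) linarith
qed

end
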